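(* Let $n$ be a positive integer such that $\sigma(n)=\sigma(n+1)$, where $\sigma(m)$ denotes the sum of the positive divisors of $m$. Then $\sigma(n)$ is divisible by $2$ or by $3$.
   Context: $\sigma(m)=\sum_{d\mid m,\ d>0} d$ is the sum of the positive divisors of $m$. *)

theory Defs
  imports "HOL-Number_Theory.Number_Theory"
begin

(* The index set is finite for m > 0; divisor_sum 0 is the junk value 0. *)
definition divisor_sum :: "nat \<Rightarrow> nat" where
  "divisor_sum m = (\<Sum>d | d dvd m \<and> d > 0. d)"

end

theory Submission
  imports Defs
begin

text \<open>
  Write \<open>N = 2\<^sup>a m\<close> with \<open>m\<close> odd. If \<open>a\<close> is odd, the divisors of \<open>N\<close> fall into pairs \<open>{d, 2d}\<close>
  where \<open>d\<close> has even 2-adic valuation, so \<open>3\<close> divides \<open>\<sigma>(N)\<close>. Modulo \<open>2\<close>, \<open>\<sigma>(N)\<close> counts the odd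
  divisors of \<open>N\<close>, that is, the divisors of \<open>m\<close>; so if \<open>\<sigma>(N)\<close> is odd then \<open>m\<close> is a square. Hence
  \<open>N\<close> is a square whenever \<open>\<sigma>(N)\<close> is divisible by neither \<open>2\<close> nor \<open>3\<close>, and \<open>n\<close> and \<open>n + 1\<close> cannot
  both be positive squares.
\<close>

text \<open>The involution sending \<open>d\<close> to \<open>m div d\<close> exchanges the divisors
  below the square root of \<open>m\<close> with those above it, and a nonsquare has no divisor at
  the root itself.\<close>

lemma even_card_divisors_nonsquare:
  fixes m :: nat
  assumes "m > 0" and nonsquare: "\<And>k. m \<noteq> k * k"
  shows "even (card {d. d dvd m})"
proof -
  define L where "L = {d. d dvd m \<and> d * d < m}"
  define G where "G = {d. d dvd m \<and> m < d * d}"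
  have fin: "finite {d. d dvd m}"
    using assms(1) by simp
  have bij: "bij_betw (\<lambda>d. m div d) L G"
  proof (rule bij_betw_byWitness[where f' = "\<lambda>d. m div d"])
    show "\<forall>d\<in>L. m div (m div d) = d" "\<forall>d\<in>G. m div (m div d) = d"
      using assms(1) by (auto simp: L_def G_def elim!: dvdE)
    show "(\<lambda>d. m div d) ` L \<subseteq> G" "(\<lambda>d. m div d) ` G \<subseteq> L"
      using assms(1) by (auto simp: L_def G_def elim!: dvdE)
  qed
  have "{d. d dvd m} = L \<union> G"
    using nonsquare by (auto simp: L_def G_def) (metis nat_neq_iff)
  moreover have "finite L" "finite G" "L \<inter> G = {}"
    using fin by (auto simp: L_def G_def)
  ultimately have "card {d. d dvd m} = card L + card G"
    by (simp add: card_Un_disjoint)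
  then show ?thesis
    using bij_betw_same_card[OF bij] by simp
qed

lemma three_dvd_divisor_sum:
  assumes "N > 0" and odd_mult: "odd (multiplicity 2 N)"
  shows "3 dvd divisor_sum N"
proof -
  define E where "E = {d. d dvd N \<and> even (multiplicity 2 d)}"
  define D where "D = {d. d dvd N \<and> odd (multiplicity 2 d)}"
  have fin: "finite E" "finite D"
    using assms(1) by (auto simp: E_def D_def)
  have mult_double: "multiplicity 2 (2 * d) = Suc (multiplicity 2 d)" if "d > 0" for d :: nat
    using that by (simp add: multiplicity_times_same)
  have "D = (\<lambda>d. 2 * d) ` E"
  proof (intro equalityI subsetI)
    fix x assume "x \<in> D"
    then have x: "x dvd N" "odd (multiplicity 2 x)" by (auto simp: D_def)
    then have "2 dvd x"
      using not_dvd_imp_multiplicity_0 by fastforce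
    then obtain d where d: "x = 2 * d" ..
    have "d > 0" using x(1) d assms(1) by (cases d) auto
    then have "d \<in> E"
      using x d mult_double by (auto simp: E_def intro: dvd_trans)
    then show "x \<in> (\<lambda>d. 2 * d) ` E" using d by blast
  next
    fix x assume "x \<in> (\<lambda>d. 2 * d) ` E"
    then obtain d where d: "x = 2 * d" "d dvd N" "even (multiplicity 2 d)"
      by (auto simp: E_def)
    then obtain k where k: "N = d * k" by blast
    have pos: "d > 0" "k > 0" using k assms(1) by auto
    \<comment> \<open>An even valuation of \<open>d\<close> leaves an odd, hence positive, one for
      the cofactor \<open>k\<close>, so \<open>2 * d\<close> still divides \<open>N\<close>.\<close>
    have "multiplicity 2 N = multiplicity 2 d + multiplicity 2 k"
      unfolding k using pos by (intro prime_elem_multiplicity_mult_distrib) auto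
    then have "odd (multiplicity 2 k)"
      using d(3) odd_mult by simp
    then have "2 dvd k"
      using not_dvd_imp_multiplicity_0 by fastforce
    then have "x dvd N" using d(1) k by (metis mult.commute mult_dvd_mono dvd_refl)
    then show "x \<in> D" using d mult_double pos by (simp add: D_def)
  qed
  then have D_sum: "\<Sum>D = 2 * \<Sum>E"
    by (simp add: sum.reindex inj_on_def sum_distrib_left)
  have "{d. d dvd N \<and> d > 0} = E \<union> D"
    using assms(1) by (auto simp: E_def D_def intro: Nat.gr0I)
  moreover have "E \<inter> D = {}"
    by (auto simp: E_def D_def)
  ultimately have "divisor_sum N = \<Sum>E + \<Sum>D"
    using fin by (simp add: divisor_sum_def sum.union_disjoint)
  then show ?thesis
    using D_sum by simp
qed

lemma odd_divisor_sum_imp_odd_part_square: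
  assumes "odd (divisor_sum (2 ^ a * m))" and "odd m"
  shows "\<exists>k. m = k * k"
proof (rule ccontr)
  assume "\<not> (\<exists>k. m = k * k)"
  then have "even (card {d. d dvd m})"
    using assms(2) by (intro even_card_divisors_nonsquare) (auto intro: Nat.gr0I)
  \<comment> \<open>The nested set is the form in which \<open>even_sum_iff\<close> counts the odd
    summands of the divisor sum.\<close>
  moreover have "{d \<in> {d. d dvd 2 ^ a * m \<and> d > 0}. odd d} = {d. d dvd m}"
  proof (intro equalityI subsetI)
    fix d assume "d \<in> {d \<in> {d. d dvd 2 ^ a * m \<and> d > 0}. odd d}"
    then have "d dvd 2 ^ a * m" "coprime d (2 ^ a)" by auto
    then show "d \<in> {d. d dvd m}" by (simp add: coprime_dvd_mult_right_iff)
  next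
    fix d assume "d \<in> {d. d dvd m}"
    then have "d dvd m" by simp
    moreover have "odd d"
      using \<open>d dvd m\<close> assms(2) dvd_trans by blast
    ultimately show "d \<in> {d \<in> {d. d dvd 2 ^ a * m \<and> d > 0}. odd d}"
      by (auto intro: Nat.gr0I)
  qed
  moreover have "finite {d. d dvd 2 ^ a * m \<and> d > 0}"
    using assms(2) by (auto intro!: finite_subset[OF _ finite_divisors_nat[of "2 ^ a * m"]] Nat.gr0I)
  ultimately show False
    using assms(1) by (simp add: divisor_sum_def even_sum_iff)
qed

lemma square_if_divisor_sum_coprime_6:
  assumes "N > 0" "odd (divisor_sum N)" "\<not> 3 dvd divisor_sum N"
  shows "\<exists>k. N = k * k"
proof -
  obtain m where m: "odd m" "N = 2 ^ multiplicity 2 N * m"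
    using assms(1) multiplicity_decompose'[of N 2] by auto
  obtain k where k: "m = k * k"
    using odd_divisor_sum_imp_odd_part_square m assms(2) by metis
  have "even (multiplicity 2 N)"
    using three_dvd_divisor_sum assms(1,3) by blast
  then obtain b where "multiplicity 2 N = b + b"
    by (metis evenE mult_2)
  then have "N = (2 ^ b * k) * (2 ^ b * k)"
    using m(2) k by (simp add: power_add mult_ac)
  then show ?thesis ..
qed

theorem theorem2:
  fixes n :: nat
  assumes "n > 0"
    and "divisor_sum n = divisor_sum (n + 1)"
  shows "2 dvd divisor_sum n \<or> 3 dvd divisor_sum n"
proof (rule ccontr)
  assume "\<not> ?thesis"
  then obtain x y where xy: "n = x * x" "n + 1 = y * y"
    using square_if_divisor_sum_coprime_6[of n] square_if_divisor_sum_coprime_6[of "n + 1"] assms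
    by auto
  then have "x < y"
    by (metis less_add_one mult_le_mono not_le)
  \<comment> \<open>Expanded, this reads \<open>n + 2 * x + 1 \<le> n + 1\<close>, which forces
    \<open>x = 0\<close> and contradicts \<open>n > 0\<close>.\<close>
  then have "Suc x * Suc x \<le> y * y"
    by (intro mult_le_mono) auto
  then show False
    using xy assms(1) by simp
qed

end
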